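(* Let $\alpha_0,c_1,c_2$ be real numbers with $c_1\ne0$, $c_2\neq0$, such that none of the hypergeometric denominators below vanishes. Let $b_n,\,\mathsf c_n,\,d_n$ be the recurrence coefficients of the multiple Laguerre polynomials of the second kind given in the context, and let $T_m$ be the corresponding tetradiagonal matrices. Put $z=\frac{c_2-c_1}{c_2}$ and for $n\ge0$ set $$a_{6n+1}=\frac{\alpha_0+2n+1}{c_1},\qquad a_{6n+4}=\frac{\alpha_0+2n+2}{c_2},$$ $$a_{6n+2}=\frac{(n)_n(\alpha_0+2n+1)(c_1-c_2)}{(n+1)_n\,c_1c_2}\cdot\frac{{}_2F_1\left[{-n,\,\alpha_0+1\atop -2n+1};z\right]}{{}_2F_1\left[{-n,\,\alpha_0+1\atop -2n};z\right]},\qquad a_{6n+5}=\frac{(n+1)(\alpha_0+2n+2)(c_2-c_1)}{(2n+1)c_1c_2}\cdot\frac{{}_2F_1\left[{-n,\,\alpha_0+1\atop -2n};z\right]}{{}_2F_1\left[{-n-1,\,\alpha_0+1\atop -2n-1};z\right]},$$ $$a_{6n+3}=\frac{2n+1}{c_1}\cdot\frac{{}_2F_1\left[{-n-1,\,\alpha_0+1\atop -2n-1};z\right]}{{}_2F_1\left[{-n,\,\alpha_0+1\atop -2n};z\right]},\qquad a_{6n+6}=\frac{2(n+1)}{c_2}\cdot\frac{{}_2F_1\left[{-n-1,\,\alpha_0+1\atop -2n-2};z\right]}{{}_2F_1\left[{-n-1,\,\alpha_0+1\atop -2n-1};z\right]}.$$ Then for every $m\ge1$ one has the bidiagonal factorization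 $T_m=L_{1,m}L_{2,m}U_m$, with $L_{1,m},L_{2,m},U_m$ built from these $a_n$ as in the context.
   Context: Matrices. Given sequences $(b_n)_{n\ge0},(\mathsf c_n)_{n\ge1},(d_n)_{n\ge2}$, $T_m$ is the $m\times m$ matrix (rows and columns numbered from $1$) with $(T_m)_{i,i}=b_{i-1}$, $(T_m)_{i,i+1}=1$, $(T_m)_{i+1,i}=\mathsf c_i$, $(T_m)_{i+2,i}=d_{i+1}$ and all other entries $0$. Given $(a_n)_{n\ge1}$: $L_{1,m}$ is the $m\times m$ lower bidiagonal matrix with $1$'s on the diagonal and $(L_{1,m})_{i+1,i}=a_{3i-1}$; $L_{2,m}$ is lower bidiagonal with $1$'s on the diagonal and $(L_{2,m})_{i+1,i}=a_{3i}$; $U_m$ is upper bidiagonal with diagonal entries $(U_m)_{i,i}=a_{3i-2}$ and $1$'s on the superdiagonal. (The subdiagonal recurrence coefficients $\mathsf c_n$ are not to be confused with the parameters $c_1,c_2$.) Notation. $(x)_k=x(x+1)\cdots(x+k-1)$, $(x)_0=1$ (in particular $(0)_0=1$). For a nonnegative integer $p$, ${}_2F_1\left[{-p,\,x\atop u};z\right]=\sum_{j=0}^{p}\frac{(-p)_j(x)_j}{(u)_j\,j!}z^j$ (terms $j>p$ are discarded even if $u$ is a nonpositive integer). Recurrence coefficients (multiple Laguerre of the second kind), $k\ge0$: $b_{2k}=\frac{k(c_1+3c_2)+c_2+\alpha_0c_2}{c_1c_2}$; $b_{2k+1}=\frac{k(3c_1+c_2)+2c_1+c_2+\alpha_0c_1}{c_1c_2}$;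 $\mathsf c_{2k}=\frac{(2k+\alpha_0)k(c_1^2+c_2^2)}{c_1^2c_2^2}$; $\mathsf c_{2k+1}=\frac{(2k+1+\alpha_0)\left(kc_1^2+(k+1)c_2^2\right)}{c_1^2c_2^2}$; $d_{2k}=\frac{k(2k+\alpha_0)(2k+\alpha_0-1)(c_2-c_1)}{c_1^3c_2}$; $d_{2k+1}=\frac{k(2k+\alpha_0)(2k+\alpha_0+1)(c_1-c_2)}{c_1c_2^3}$. *)

theory Defs
  imports Complex_Main "Jordan_Normal_Form.Matrix"
begin

text \<open>
  Matrices are numbered from 1 in the definitions below, whereas library matrices are indexed
  from 0; the first function performs the shift. The sequences are total functions on the
  naturals, of which only the entries \<open>b 0, \<dots>\<close>, \<open>c 1, \<dots>\<close>, \<open>d 2, \<dots>\<close> and \<open>a 1, \<dots>\<close> occur in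
  the matrices.
\<close>

definition mat_from_1 :: "nat \<Rightarrow> (nat \<Rightarrow> nat \<Rightarrow> 'a) \<Rightarrow> 'a mat" where
  "mat_from_1 m f = mat m m (\<lambda>(i, j). f (i + 1) (j + 1))"

definition tetra_T ::
  "(nat \<Rightarrow> real) \<Rightarrow> (nat \<Rightarrow> real) \<Rightarrow> (nat \<Rightarrow> real) \<Rightarrow> nat \<Rightarrow> real mat" where
  "tetra_T b c d m = mat_from_1 m (\<lambda>i j.
     if j = i then b (i - 1)
     else if j = i + 1 then 1
     else if i = j + 1 then c j
     else if i = j + 2 then d (j + 1)
     else 0)"

definition bidiag_L1 :: "(nat \<Rightarrow> real) \<Rightarrow> nat \<Rightarrow> real mat" where
  "bidiag_L1 a m = mat_from_1 m (\<lambda>i j.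
     if j = i then 1 else if i = j + 1 then a (3 * j - 1) else 0)"

definition bidiag_L2 :: "(nat \<Rightarrow> real) \<Rightarrow> nat \<Rightarrow> real mat" where
  "bidiag_L2 a m = mat_from_1 m (\<lambda>i j.
     if j = i then 1 else if i = j + 1 then a (3 * j) else 0)"

definition bidiag_U :: "(nat \<Rightarrow> real) \<Rightarrow> nat \<Rightarrow> real mat" where
  "bidiag_U a m = mat_from_1 m (\<lambda>i j.
     if j = i then a (3 * i - 2) else if j = i + 1 then 1 else 0)"

text \<open>
  The terminating series with upper parameters \<open>-p\<close> and \<open>x\<close>, lower parameter \<open>u\<close> and argument
  \<open>z\<close>. It is cut off at \<open>j = p\<close> by definition, so nonpositive integers \<open>u\<close> are admissible as
  long as \<open>pochhammer u j\<close> does not vanish for \<open>j \<le> p\<close>. This holds for every instance used here.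
\<close>

definition hyp2F1 :: "nat \<Rightarrow> real \<Rightarrow> real \<Rightarrow> real \<Rightarrow> real" where
  "hyp2F1 p x u z =
     (\<Sum>j = 0..p. pochhammer (- real p) j * pochhammer x j / (pochhammer u j * fact j) * z ^ j)"

text \<open>Recurrence coefficients of the multiple Laguerre polynomials of the second kind.\<close>

definition lag2_b :: "real \<Rightarrow> real \<Rightarrow> real \<Rightarrow> nat \<Rightarrow> real" where
  "lag2_b \<alpha>0 c1 c2 n = (let k = real (n div 2) in
     if even n then (k * (c1 + 3 * c2) + c2 + \<alpha>0 * c2) / (c1 * c2)
     else (k * (3 * c1 + c2) + 2 * c1 + c2 + \<alpha>0 * c1) / (c1 * c2))"

definition lag2_c :: "real \<Rightarrow> real \<Rightarrow> real \<Rightarrow> nat \<Rightarrow> real" where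
  "lag2_c \<alpha>0 c1 c2 n = (let k = real (n div 2) in
     if even n then (2 * k + \<alpha>0) * k * (c1\<^sup>2 + c2\<^sup>2) / (c1\<^sup>2 * c2\<^sup>2)
     else (2 * k + 1 + \<alpha>0) * (k * c1\<^sup>2 + (k + 1) * c2\<^sup>2) / (c1\<^sup>2 * c2\<^sup>2))"

definition lag2_d :: "real \<Rightarrow> real \<Rightarrow> real \<Rightarrow> nat \<Rightarrow> real" where
  "lag2_d \<alpha>0 c1 c2 n = (let k = real (n div 2) in
     if even n then k * (2 * k + \<alpha>0) * (2 * k + \<alpha>0 - 1) * (c2 - c1) / (c1 ^ 3 * c2)
     else k * (2 * k + \<alpha>0) * (2 * k + \<alpha>0 + 1) * (c1 - c2) / (c1 * c2 ^ 3))"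

text \<open>
  The entries of the bidiagonal factors, given by residue of the index \<open>i\<close> modulo 6; the index 0
  is not used. The explicit equations for the indices \<open>6n + 1, \<dots>, 6n + 6\<close> follow the definition.
\<close>

definition lag2_a :: "real \<Rightarrow> real \<Rightarrow> real \<Rightarrow> nat \<Rightarrow> real" where
  "lag2_a \<alpha>0 c1 c2 i =
    (let n = (i - 1) div 6; r = (i - 1) mod 6 + 1; N = real n; z = (c2 - c1) / c2 in
     if r = 1 then (\<alpha>0 + 2 * N + 1) / c1
     else if r = 2 then
       pochhammer N n * (\<alpha>0 + 2 * N + 1) * (c1 - c2) / (pochhammer (N + 1) n * c1 * c2)
         * (hyp2F1 n (\<alpha>0 + 1) (- 2 * N + 1) z / hyp2F1 n (\<alpha>0 + 1) (- 2 * N) z)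
     else if r = 3 then
       (2 * N + 1) / c1
         * (hyp2F1 (n + 1) (\<alpha>0 + 1) (- 2 * N - 1) z / hyp2F1 n (\<alpha>0 + 1) (- 2 * N) z)
     else if r = 4 then (\<alpha>0 + 2 * N + 2) / c2
     else if r = 5 then
       (N + 1) * (\<alpha>0 + 2 * N + 2) * (c2 - c1) / ((2 * N + 1) * c1 * c2)
         * (hyp2F1 n (\<alpha>0 + 1) (- 2 * N) z / hyp2F1 (n + 1) (\<alpha>0 + 1) (- 2 * N - 1) z)
     else
       2 * (N + 1) / c2
         * (hyp2F1 (n + 1) (\<alpha>0 + 1) (- 2 * N - 2) z
            / hyp2F1 (n + 1) (\<alpha>0 + 1) (- 2 * N - 1) z))"

lemma lag2_a_simps:
  fixes n :: nat and \<alpha>0 c1 c2 :: real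
  defines "z \<equiv> (c2 - c1) / c2"
  shows
    "lag2_a \<alpha>0 c1 c2 (6 * n + 1) = (\<alpha>0 + 2 * real n + 1) / c1"
    "lag2_a \<alpha>0 c1 c2 (6 * n + 2) =
       pochhammer (real n) n * (\<alpha>0 + 2 * real n + 1) * (c1 - c2)
         / (pochhammer (real n + 1) n * c1 * c2)
         * (hyp2F1 n (\<alpha>0 + 1) (- 2 * real n + 1) z / hyp2F1 n (\<alpha>0 + 1) (- 2 * real n) z)"
    "lag2_a \<alpha>0 c1 c2 (6 * n + 3) = (2 * real n + 1) / c1
         * (hyp2F1 (n + 1) (\<alpha>0 + 1) (- 2 * real n - 1) z / hyp2F1 n (\<alpha>0 + 1) (- 2 * real n) z)"
    "lag2_a \<alpha>0 c1 c2 (6 * n + 4) = (\<alpha>0 + 2 * real n + 2) / c2"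
    "lag2_a \<alpha>0 c1 c2 (6 * n + 5) =
       (real n + 1) * (\<alpha>0 + 2 * real n + 2) * (c2 - c1) / ((2 * real n + 1) * c1 * c2)
         * (hyp2F1 n (\<alpha>0 + 1) (- 2 * real n) z / hyp2F1 (n + 1) (\<alpha>0 + 1) (- 2 * real n - 1) z)"
    "lag2_a \<alpha>0 c1 c2 (6 * n + 6) = 2 * (real n + 1) / c2
         * (hyp2F1 (n + 1) (\<alpha>0 + 1) (- 2 * real n - 2) z
            / hyp2F1 (n + 1) (\<alpha>0 + 1) (- 2 * real n - 1) z)"
proof -
  have dm: "(6 * n + s) div 6 = n" "(6 * n + s) mod 6 = s" if "s < 6" for s
    using that by simp_all
  show "lag2_a \<alpha>0 c1 c2 (6 * n + 1) = (\<alpha>0 + 2 * real n + 1) / c1"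
    using dm[of 0] by (simp add: lag2_a_def Let_def)
  show "lag2_a \<alpha>0 c1 c2 (6 * n + 2) =
       pochhammer (real n) n * (\<alpha>0 + 2 * real n + 1) * (c1 - c2)
         / (pochhammer (real n + 1) n * c1 * c2)
         * (hyp2F1 n (\<alpha>0 + 1) (- 2 * real n + 1) z / hyp2F1 n (\<alpha>0 + 1) (- 2 * real n) z)"
    using dm[of 1] by (simp add: lag2_a_def Let_def z_def)
  show "lag2_a \<alpha>0 c1 c2 (6 * n + 3) = (2 * real n + 1) / c1
         * (hyp2F1 (n + 1) (\<alpha>0 + 1) (- 2 * real n - 1) z / hyp2F1 n (\<alpha>0 + 1) (- 2 * real n) z)"
    using dm[of 2] by (simp add: lag2_a_def Let_def z_def)
  show "lag2_a \<alpha>0 c1 c2 (6 * n + 4) = (\<alpha>0 + 2 * real n + 2) / c2"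
    using dm[of 3] by (simp add: lag2_a_def Let_def)
  show "lag2_a \<alpha>0 c1 c2 (6 * n + 5) =
       (real n + 1) * (\<alpha>0 + 2 * real n + 2) * (c2 - c1) / ((2 * real n + 1) * c1 * c2)
         * (hyp2F1 n (\<alpha>0 + 1) (- 2 * real n) z / hyp2F1 (n + 1) (\<alpha>0 + 1) (- 2 * real n - 1) z)"
    using dm[of 4] by (simp add: lag2_a_def Let_def z_def)
  show "lag2_a \<alpha>0 c1 c2 (6 * n + 6) = 2 * (real n + 1) / c2
         * (hyp2F1 (n + 1) (\<alpha>0 + 1) (- 2 * real n - 2) z
            / hyp2F1 (n + 1) (\<alpha>0 + 1) (- 2 * real n - 1) z)"
    using dm[of 5] by (simp add: lag2_a_def Let_def z_def)
qed

end

theory Submission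
  imports Defs
begin

text \<open>
  Multiplying out, \<open>L\<^sub>1 L\<^sub>2 U\<close> is tetradiagonal and its entries are polynomials of degree at most
  three in the \<open>a\<close>'s. With \<open>A\<^sub>n\<close> and \<open>B\<^sub>n\<close> the series with parameters \<open>-n; -2n\<close> and
  \<open>-n-1; -2n-1\<close>, all series occurring in the \<open>a\<close>'s are of one of these two kinds. In the second
  subdiagonal, and in the products \<open>a\<^bsub>3i+2\<^esub> a\<^bsub>3i\<^esub>\<close>, the series cancel. The diagonal amounts to two
  contiguous relations, expressing \<open>B\<^sub>n\<close> by \<open>A\<^sub>n, B\<^bsub>n-1\<^esub>\<close> and \<open>A\<^bsub>n+1\<^esub>\<close> by \<open>A\<^sub>n, B\<^sub>n\<close>; the first
  subdiagonal then follows from the diagonal. The contiguous relations hold already for the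
  coefficients of \<open>(x)\<^sub>k z\<^sup>k\<close> and \<open>(x)\<^sub>k z\<^bsup>k+1\<^esup>\<close>, because
  \<open>(x + s) (x)\<^sub>k = (x)\<^bsub>k+1\<^esub> + (s - k) (x)\<^sub>k\<close>.
\<close>

section \<open>Products of bidiagonal matrices\<close>

text \<open>Left multiplication by such a factor is a row operation, so the triple product is
  evaluated by using this twice. Positions are counted from 0 but \<open>e\<close> from 1, which is
  why row \<open>i\<close> receives \<open>e i\<close>.\<close>

lemma lower_bidiagonal_mult_index:
  fixes X :: "real mat"
  assumes X: "X \<in> carrier_mat m m" and i: "i < m" and j: "j < m"
  shows "(mat_from_1 m (\<lambda>i j. if j = i then 1 else if i = j + 1 then e j else 0) * X) $$ (i, j)
    = X $$ (i, j) + (if i = 0 then 0 else e i * X $$ (i - 1, j))"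
proof -
  have "(mat_from_1 m (\<lambda>i j. if j = i then 1 else if i = j + 1 then e j else 0) * X) $$ (i, j)
      = (\<Sum>k = 0..<m. (if k = i then 1 else if i = k + 1 then e (k + 1) else 0) * X $$ (k, j))"
    using X i j by (auto simp: mat_from_1_def scalar_prod_def intro!: sum.cong)
  also have "\<dots> = (\<Sum>k = 0..<m. (if k = i then X $$ (i, j) else 0)
      + (if i = k + 1 then e i * X $$ (i - 1, j) else 0))"
    by (intro sum.cong) auto
  also have "\<dots> = X $$ (i, j) + (\<Sum>k = 0..<m. if i = k + 1 then e i * X $$ (i - 1, j) else 0)"
    using i by (simp add: sum.distrib)
  also have "(\<Sum>k = 0..<m. if i = k + 1 then e i * X $$ (i - 1, j) else 0)
      = (if i = 0 then 0 else e i * X $$ (i - 1, j))"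
    using i by (cases i) auto
  finally show ?thesis .
qed

lemma tetra_T_eq_bidiag_mult:
  assumes b0: "b 0 = a 1"
    and b: "\<And>i. b (Suc i) = a (3 * i + 4) + a (3 * i + 2) + a (3 * i + 3)"
    and c1: "c 1 = (a 2 + a 3) * a 1"
    and c: "\<And>i. c (i + 2) = (a (3 * i + 5) + a (3 * i + 6)) * a (3 * i + 4)
                             + a (3 * i + 5) * a (3 * i + 3)"
    and d: "\<And>i. d (i + 2) = a (3 * i + 5) * a (3 * i + 3) * a (3 * i + 1)"
  shows "tetra_T b c d m = bidiag_L1 a m * bidiag_L2 a m * bidiag_U a m"
proof -
  have car [simp]: "bidiag_L1 a m \<in> carrier_mat m m" "bidiag_L2 a m \<in> carrier_mat m m"
    "bidiag_U a m \<in> carrier_mat m m" "tetra_T b c d m \<in> carrier_mat m m"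
    by (simp_all add: bidiag_L1_def bidiag_L2_def bidiag_U_def tetra_T_def mat_from_1_def)
  have U: "bidiag_U a m $$ (i, j) = (if j = i then a (3 * i + 1) else if j = i + 1 then 1 else 0)"
    if "i < m" "j < m" for i j
    using that by (simp add: bidiag_U_def mat_from_1_def)
  have L2U: "(bidiag_L2 a m * bidiag_U a m) $$ (i, j) = bidiag_U a m $$ (i, j)
      + (if i = 0 then 0 else a (3 * i) * bidiag_U a m $$ (i - 1, j))" if "i < m" "j < m" for i j
    unfolding bidiag_L2_def using that by (intro lower_bidiagonal_mult_index) auto
  have L1L2U: "(bidiag_L1 a m * (bidiag_L2 a m * bidiag_U a m)) $$ (i, j)
      = (bidiag_L2 a m * bidiag_U a m) $$ (i, j)
        + (if i = 0 then 0 else a (3 * i - 1) * (bidiag_L2 a m * bidiag_U a m) $$ (i - 1, j))"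
    if "i < m" "j < m" for i j
    unfolding bidiag_L1_def using that mult_carrier_mat[OF car(2,3)]
    by (intro lower_bidiagonal_mult_index) auto
  have T: "tetra_T b c d m $$ (i, j) = (if j = i then b i else if j = i + 1 then 1
      else if i = j + 1 then c i else if i = j + 2 then d i else 0)" if "i < m" "j < m" for i j
    using that by (auto simp: tetra_T_def mat_from_1_def)
  have "tetra_T b c d m $$ (i, j) = (bidiag_L1 a m * (bidiag_L2 a m * bidiag_U a m)) $$ (i, j)"
    if ij: "i < m" "j < m" for i j
  proof -
    \<comment> \<open>Row \<open>i\<close> of the product combines rows \<open>i\<close>,
      \<open>i - 1\<close> and \<open>i - 2\<close> of \<open>bidiag_U a m\<close>; the rows where
      some of these do not exist are treated separately.\<close>
    consider "i = 0" | "i = 1" | l where "i = Suc (Suc l)"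
      by (metis One_nat_def not0_implies_Suc)
    then show ?thesis
    proof cases
      case 1
      then show ?thesis using ij by (simp add: T L1L2U L2U U b0)
    next
      case 2
      then show ?thesis
        using ij b[of 0] c1 by (auto simp: T L1L2U L2U U algebra_simps eval_nat_numeral)
    next
      case (3 l)
      then show ?thesis
        using ij b[of "Suc l"] c[of l] d[of l]
        by (auto simp: T L1L2U L2U U algebra_simps eval_nat_numeral)
    qed
  qed
  then have "tetra_T b c d m = bidiag_L1 a m * (bidiag_L2 a m * bidiag_U a m)"
    using car(1,3,4) by (intro eq_matI) (simp_all del: car index_mult_mat(1))
  then show ?thesis
    using assoc_mult_mat[OF car(1,2,3)] by simp
qed

section \<open>Contiguous relations\<close>

text \<open>The factor \<open>pochhammer x k * z ^ k\<close> is left out, so that relations between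
  series become rational identities in \<open>k\<close>.\<close>

definition hyp_coeff :: "nat \<Rightarrow> nat \<Rightarrow> nat \<Rightarrow> real" where
  "hyp_coeff p q k = pochhammer (- real p) k / (pochhammer (- real q) k * fact k)"

lemma hyp_coeff_0 [simp]: "hyp_coeff p q 0 = 1"
  by (simp add: hyp_coeff_def)

lemma hyp_coeff_eq_0: "p < k \<Longrightarrow> hyp_coeff p q k = 0"
  by (simp add: hyp_coeff_def pochhammer_of_nat_eq_0_iff)

text \<open>The free bound \<open>N\<close> lets series of different lengths be combined
  termwise.\<close>

lemma hyp2F1_altdef:
  assumes "p \<le> N"
  shows "hyp2F1 p x (- real q) z = (\<Sum>k\<le>N. hyp_coeff p q k * (pochhammer x k * z ^ k))"
proof -
  have "hyp2F1 p x (- real q) z = (\<Sum>k\<le>p. hyp_coeff p q k * (pochhammer x k * z ^ k))"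
    by (auto simp: hyp2F1_def hyp_coeff_def atMost_atLeast0 intro!: sum.cong)
  also have "\<dots> = (\<Sum>k\<le>N. hyp_coeff p q k * (pochhammer x k * z ^ k))"
    using assms by (intro sum.mono_neutral_left) (auto simp: hyp_coeff_eq_0)
  finally show ?thesis .
qed

text \<open>Up to sign, both sides are \<open>pochhammer (- real (Suc q)) (Suc k)\<close>, with the
  last or the first factor split off.\<close>

lemma pochhammer_neg_Suc:
  "pochhammer (- real (Suc q)) k * (real q + 1 - real k) = (real q + 1) * pochhammer (- real q) k"
proof -
  have "pochhammer (- real (Suc q)) k * (- real (Suc q) + real k)
      = - real (Suc q) * pochhammer (- real (Suc q) + 1) k"
    by (metis pochhammer_Suc pochhammer_rec)
  then show ?thesis by (simp add: algebra_simps)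
qed

lemma hyp_coeff_Suc_Suc_Suc:
  "(real q + 1) * (real k + 1) * hyp_coeff (Suc p) (Suc q) (Suc k) = (real p + 1) * hyp_coeff p q k"
proof -
  have 1: "pochhammer (- real (Suc n)) (Suc k) = - (real n + 1) * pochhammer (- real n) k" for n
    by (simp add: pochhammer_rec)
  show ?thesis
  \<comment> \<open>If this symbol vanishes, so do both denominators, and both sides are 0 by the
    convention for division by zero.\<close>
  proof (cases "pochhammer (- real q) k = 0")
    case False
    have "- (real q + 1) \<noteq> 0" "real k + 1 \<noteq> 0" by linarith+
    then show ?thesis
      unfolding hyp_coeff_def 1 fact_Suc using False by (simp add: divide_simps) (simp add: algebra_simps)
  qed (unfold hyp_coeff_def 1, simp)
qed

lemma hyp_coeff_Suc_upper:
  "(real p + 1 - real k) * hyp_coeff (Suc p) q k = (real p + 1) * hyp_coeff p q k"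
  using pochhammer_neg_Suc[of p k] by (simp add: hyp_coeff_def mult_ac)

text \<open>Since \<open>p \<le> q\<close>, the denominators are nonzero for
  \<open>k \<le> p\<close>; beyond \<open>p\<close> both sides vanish.\<close>

lemma hyp_coeff_Suc_lower:
  assumes "p \<le> q"
  shows "(real q + 1) * hyp_coeff p (Suc q) k = (real q + 1 - real k) * hyp_coeff p q k"
proof (cases "k \<le> p")
  case True
  then have "pochhammer (- real (Suc q)) k \<noteq> 0" "pochhammer (- real q) k \<noteq> 0"
    using assms by (auto simp: pochhammer_of_nat_eq_0_iff simp del: of_nat_Suc)
  then show ?thesis
    using pochhammer_neg_Suc[of q k] by (simp add: hyp_coeff_def divide_simps) (simp add: mult_ac)
next
  case False
  then show ?thesis by (simp add: hyp_coeff_eq_0)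
qed

text \<open>This trades the factor \<open>x + s\<close> for an index shift, so that coefficients
  free of \<open>x\<close> can be compared. The hypothesis removes the top term of the shifted
  sum.\<close>

lemma sum_mult_linear_pochhammer:
  fixes x s z :: real
  assumes "f (Suc N) = 0"
  shows "(x + s) * z * (\<Sum>k\<le>Suc N. f k * (pochhammer x k * z ^ k))
    = (\<Sum>k\<le>N. f k * (pochhammer x (Suc k) * z ^ Suc k))
      + z * (\<Sum>k\<le>Suc N. (s - real k) * f k * (pochhammer x k * z ^ k))"
proof -
  have "(x + s) * z * (\<Sum>k\<le>Suc N. f k * (pochhammer x k * z ^ k))
    = (\<Sum>k\<le>Suc N. f k * (pochhammer x (Suc k) * z ^ Suc k)
        + z * ((s - real k) * f k * (pochhammer x k * z ^ k)))"
    unfolding sum_distrib_left by (intro sum.cong) (auto simp: pochhammer_Suc algebra_simps)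
  then show ?thesis
    using assms by (simp only: sum.distrib sum_distrib_left[symmetric] sum.atMost_Suc)
qed

text \<open>The shift \<open>s = 2 * n + 2\<close> is chosen so that \<open>s - k\<close> is the
  factor turning the coefficients \<open>C\<close> into multiples of \<open>A\<close>. Then
  \<open>low\<close> settles the terms in \<open>z * t k\<close>, and \<open>high\<close> those in
  \<open>t (Suc k)\<close>.\<close>

lemma hyp2F1_contiguous_odd:
  "2 * (2 * real n + 3) * hyp2F1 (n + 2) x (- real (2 * n + 3)) z
    = 2 * (2 * real n + 3 - (real n + 1) * z) * hyp2F1 (n + 1) x (- real (2 * n + 2)) z
      + (x + 2 * real n + 2) * z * hyp2F1 (n + 1) x (- real (2 * n + 1)) z"
proof -
  define t where "t k = pochhammer x k * z ^ k" for k
  define A where "A k = hyp_coeff (n + 1) (2 * n + 2) k" for k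
  define B where "B k = hyp_coeff (n + 2) (2 * n + 3) k" for k
  define C where "C k = hyp_coeff (n + 1) (2 * n + 1) k" for k
  have low: "(2 * real n + 2 - real k) * C k = 2 * (real n + 1) * A k" for k
    using hyp_coeff_Suc_lower[of "n + 1" "2 * n + 1" k]
    by (simp add: A_def C_def algebra_simps)
  \<comment> \<open>After multiplication by \<open>2 * (k + 1) * (n + 1)\<close>, everything is a
    multiple of \<open>C k\<close>, and a polynomial identity in \<open>n\<close> and
    \<open>k\<close> remains.\<close>
  have high: "2 * (2 * real n + 3) * B (Suc k) = 2 * (2 * real n + 3) * A (Suc k) + C k" for k
  proof -
    have B: "(2 * real n + 3) * (real k + 1) * B (Suc k) = (real n + 2) * A k"
      using hyp_coeff_Suc_Suc_Suc[of "2 * n + 2" k "n + 1"]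
      by (simp add: A_def B_def numeral_eq_Suc algebra_simps)
    have A: "2 * (real k + 1) * (real n + 1) * A (Suc k) = (real n + 1 - real k) * C k"
      using hyp_coeff_Suc_Suc_Suc[of "2 * n + 1" k n] hyp_coeff_Suc_upper[of n k "2 * n + 1"]
      by (simp add: A_def C_def numeral_eq_Suc algebra_simps)
    have "2 * (real k + 1) * (real n + 1) * (2 * (2 * real n + 3) * B (Suc k))
        = 4 * (real n + 1) * ((2 * real n + 3) * (real k + 1) * B (Suc k))"
      by (simp add: algebra_simps)
    also have "\<dots> = 2 * (real n + 2) * (2 * (real n + 1) * A k)"
      unfolding B by (simp add: algebra_simps)
    also have "\<dots> = 2 * (2 * real n + 3) * ((real n + 1 - real k) * C k)
        + 2 * (real k + 1) * (real n + 1) * C k"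
      unfolding low[symmetric] by (simp add: algebra_simps)
    also have "\<dots> = 2 * (real k + 1) * (real n + 1) * (2 * (2 * real n + 3) * A (Suc k) + C k)"
      unfolding A[symmetric] by (simp add: algebra_simps)
    finally show ?thesis by (simp del: of_nat_Suc)
  qed
  have "C (Suc (n + 1)) = 0" by (simp add: C_def hyp_coeff_eq_0)
  then have "(x + (2 * real n + 2)) * z * (\<Sum>k\<le>Suc (n + 1). C k * t k)
      = (\<Sum>k\<le>n + 1. C k * t (Suc k))
        + z * (\<Sum>k\<le>Suc (n + 1). (2 * real n + 2 - real k) * C k * t k)"
    unfolding t_def by (rule sum_mult_linear_pochhammer)
  also have "(\<Sum>k\<le>n + 1. C k * t (Suc k))
      = (\<Sum>k\<le>n + 1. 2 * (2 * real n + 3) * (B (Suc k) * t (Suc k) - A (Suc k) * t (Suc k)))"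
  proof (intro sum.cong refl)
    fix k show "C k * t (Suc k)
        = 2 * (2 * real n + 3) * (B (Suc k) * t (Suc k) - A (Suc k) * t (Suc k))"
      unfolding right_diff_distrib mult.assoc[symmetric] high by (simp add: algebra_simps)
  qed
  \<comment> \<open>The index 0 can be added to both sums because
    \<open>A 0 = B 0 = 1\<close>.\<close>
  also have "\<dots> = 2 * (2 * real n + 3) *
      ((\<Sum>k\<le>Suc (n + 1). B k * t k) - (\<Sum>k\<le>Suc (n + 1). A k * t k))"
    unfolding sum.atMost_Suc_shift sum_distrib_left[symmetric] sum_subtractf
    by (simp add: A_def B_def)
  also have "(\<Sum>k\<le>Suc (n + 1). (2 * real n + 2 - real k) * C k * t k)
      = 2 * (real n + 1) * (\<Sum>k\<le>Suc (n + 1). A k * t k)"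
    unfolding low sum_distrib_left by (simp only: mult.assoc)
  finally have main: "(x + (2 * real n + 2)) * z * (\<Sum>k\<le>Suc (n + 1). C k * t k)
      = 2 * (2 * real n + 3) *
          ((\<Sum>k\<le>Suc (n + 1). B k * t k) - (\<Sum>k\<le>Suc (n + 1). A k * t k))
        + z * (2 * (real n + 1) * (\<Sum>k\<le>Suc (n + 1). A k * t k))" .
  have F: "hyp2F1 (n + 2) x (- real (2 * n + 3)) z = (\<Sum>k\<le>Suc (n + 1). B k * t k)"
    "hyp2F1 (n + 1) x (- real (2 * n + 2)) z = (\<Sum>k\<le>Suc (n + 1). A k * t k)"
    "hyp2F1 (n + 1) x (- real (2 * n + 1)) z = (\<Sum>k\<le>Suc (n + 1). C k * t k)"
    unfolding A_def B_def C_def t_def by (intro hyp2F1_altdef; simp)+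
  show ?thesis using main unfolding F[symmetric] by (simp add: algebra_simps)
qed

text \<open>By fact \<open>C\<close>, the factor \<open>2 * n + 2 - k\<close> turns
  \<open>B k\<close> into a multiple of \<open>C k\<close>. Hence any linear polynomial in
  \<open>k\<close> times \<open>B k\<close> is a combination of \<open>B k\<close> and
  \<open>C k\<close>; \<open>low\<close> and \<open>high\<close> are two instances.\<close>

lemma hyp2F1_contiguous_even:
  "2 * (2 * real n + 1) * (1 - z) * hyp2F1 (n + 1) x (- real (2 * n + 2)) z
    = (2 * real n + 1) * (2 - z) * hyp2F1 (n + 1) x (- real (2 * n + 1)) z
      - (x + 2 * real n + 1) * z * hyp2F1 n x (- real (2 * n)) z"
proof -
  define t where "t k = pochhammer x k * z ^ k" for k
  define A where "A k = hyp_coeff n (2 * n) k" for k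
  define B where "B k = hyp_coeff (n + 1) (2 * n + 1) k" for k
  define C where "C k = hyp_coeff (n + 1) (2 * n + 2) k" for k
  have C: "2 * (real n + 1) * C k = (2 * real n + 2 - real k) * B k" for k
    using hyp_coeff_Suc_lower[of "n + 1" "2 * n + 1" k]
    by (simp add: B_def C_def algebra_simps)
  have low: "(2 * real n + 1 - real k) * A k = (2 * real n + 1) * (2 * C k - B k)" for k
  proof -
    have "(real n + 1) * ((2 * real n + 1 - real k) * A k)
        = (2 * real n + 1) * ((real n + 1 - real k) * B k)"
      \<comment> \<open>The link between \<open>A k\<close> and \<open>B k\<close> is
        \<open>hyp_coeff n (2 * n + 1) k\<close>.\<close>
      using hyp_coeff_Suc_lower[of n "2 * n" k] hyp_coeff_Suc_upper[of n k "2 * n + 1"]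
      by (simp add: A_def B_def) algebra
    also have "\<dots> = (2 * real n + 1) * ((2 * real n + 2 - real k) * B k - (real n + 1) * B k)"
      by (simp add: algebra_simps)
    also have "\<dots> = (real n + 1) * ((2 * real n + 1) * (2 * C k - B k))"
      unfolding C[symmetric] by (simp add: algebra_simps)
    finally show ?thesis by (simp del: of_nat_Suc)
  qed
  have high: "A k = 2 * (2 * real n + 1) * (B (Suc k) - C (Suc k))" for k
  proof -
    have "(real n + 1) * A k = (2 * real n + 1) * (real k + 1) * B (Suc k)"
      using hyp_coeff_Suc_Suc_Suc[of "2 * n" k n] by (simp add: A_def B_def)
    also have "\<dots> = (2 * real n + 1)
        * (2 * (real n + 1) * B (Suc k) - (2 * real n + 2 - real (Suc k)) * B (Suc k))"
      by (simp add: algebra_simps)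
    also have "\<dots> = (real n + 1) * (2 * (2 * real n + 1) * (B (Suc k) - C (Suc k)))"
      unfolding C[symmetric] by (simp add: algebra_simps)
    finally show ?thesis by (simp del: of_nat_Suc)
  qed
  have "A (Suc n) = 0" by (simp add: A_def hyp_coeff_eq_0)
  then have "(x + (2 * real n + 1)) * z * (\<Sum>k\<le>Suc n. A k * t k)
      = (\<Sum>k\<le>n. A k * t (Suc k))
        + z * (\<Sum>k\<le>Suc n. (2 * real n + 1 - real k) * A k * t k)"
    unfolding t_def by (rule sum_mult_linear_pochhammer)
  also have "(\<Sum>k\<le>n. A k * t (Suc k))
      = (\<Sum>k\<le>n. 2 * (2 * real n + 1) * (B (Suc k) * t (Suc k) - C (Suc k) * t (Suc k)))"
    by (intro sum.cong refl, subst high) (simp add: algebra_simps)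
  also have "\<dots> = 2 * (2 * real n + 1) *
      ((\<Sum>k\<le>Suc n. B k * t k) - (\<Sum>k\<le>Suc n. C k * t k))"
    unfolding sum.atMost_Suc_shift sum_distrib_left[symmetric] sum_subtractf
    by (simp add: B_def C_def)
  also have "(\<Sum>k\<le>Suc n. (2 * real n + 1 - real k) * A k * t k)
      = (\<Sum>k\<le>Suc n. (2 * real n + 1) * (2 * (C k * t k) - B k * t k))"
    unfolding low by (intro sum.cong refl) (simp add: algebra_simps)
  also have "\<dots> = (2 * real n + 1) * (2 * (\<Sum>k\<le>Suc n. C k * t k) - (\<Sum>k\<le>Suc n. B k * t k))"
    by (simp only: sum_distrib_left[symmetric] sum_subtractf)
  finally have main: "(x + (2 * real n + 1)) * z * (\<Sum>k\<le>Suc n. A k * t k)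
      = 2 * (2 * real n + 1) * ((\<Sum>k\<le>Suc n. B k * t k) - (\<Sum>k\<le>Suc n. C k * t k))
        + z * ((2 * real n + 1) * (2 * (\<Sum>k\<le>Suc n. C k * t k) - (\<Sum>k\<le>Suc n. B k * t k)))" .
  have F: "hyp2F1 n x (- real (2 * n)) z = (\<Sum>k\<le>Suc n. A k * t k)"
    "hyp2F1 (n + 1) x (- real (2 * n + 1)) z = (\<Sum>k\<le>Suc n. B k * t k)"
    "hyp2F1 (n + 1) x (- real (2 * n + 2)) z = (\<Sum>k\<le>Suc n. C k * t k)"
    unfolding A_def B_def C_def t_def by (intro hyp2F1_altdef; simp)+
  show ?thesis using main unfolding F[symmetric] by (simp add: algebra_simps)
qed

section \<open>The factorization\<close>

text \<open>In \<open>pochhammer (n + 1) (n + 2)\<close> the last factor, \<open>2 * n + 2\<close>,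
  is twice the first. The quotient is the prefactor in \<open>a (6 * n + 8)\<close>.\<close>

lemma pochhammer_ratio_half:
  "pochhammer (real n + 1) (n + 1) / pochhammer (real n + 2) (n + 1) = 1 / 2"
proof -
  have "pochhammer (real n + 1) (Suc (n + 1)) = (real n + 1) * pochhammer (real n + 2) (n + 1)"
    by (subst pochhammer_rec) (simp add: add_ac)
  moreover have "pochhammer (real n + 1) (Suc (n + 1))
      = pochhammer (real n + 1) (n + 1) * (2 * real n + 2)"
    by (subst pochhammer_Suc) (simp add: algebra_simps)
  moreover have "pochhammer (real n + 2) (n + 1) > 0"
    by (intro pochhammer_pos) simp
  ultimately have ratio: "(real n + 1) * (2 * pochhammer (real n + 1) (n + 1))
      = (real n + 1) * pochhammer (real n + 2) (n + 1)" "pochhammer (real n + 2) (n + 1) \<noteq> 0"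
    by (simp_all add: algebra_simps)
  from ratio(1) have "2 * pochhammer (real n + 1) (n + 1) = pochhammer (real n + 2) (n + 1)"
    unfolding mult_cancel_left by linarith
  then show ?thesis using ratio(2) by simp
qed

theorem proposition3p7:
  fixes \<alpha>0 c1 c2 z :: real and m :: nat
  assumes c1: "c1 \<noteq> 0" and c2: "c2 \<noteq> 0"
    and z: "z = (c2 - c1) / c2"
    and den1: "\<And>n. hyp2F1 n (\<alpha>0 + 1) (- 2 * real n) z \<noteq> 0"
    and den2: "\<And>n. hyp2F1 (n + 1) (\<alpha>0 + 1) (- 2 * real n - 1) z \<noteq> 0"
    and m: "m \<ge> 1"
  shows "tetra_T (lag2_b \<alpha>0 c1 c2) (lag2_c \<alpha>0 c1 c2) (lag2_d \<alpha>0 c1 c2) m =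
    bidiag_L1 (lag2_a \<alpha>0 c1 c2) m * bidiag_L2 (lag2_a \<alpha>0 c1 c2) m * bidiag_U (lag2_a \<alpha>0 c1 c2) m"
proof -
  define a where "a = lag2_a \<alpha>0 c1 c2"
  define x where "x = \<alpha>0 + 1"
  define A where "A n = hyp2F1 n x (- real (2 * n)) z" for n
  define B where "B n = hyp2F1 (n + 1) x (- real (2 * n + 1)) z" for n
  have lower: "- real (2 * n) = - 2 * real n" "- real (2 * n + 1) = - 2 * real n - 1"
    "- real (2 * Suc n) = - 2 * real n - 2" for n
    by simp_all
  have A0: "A n \<noteq> 0" and B0: "B n \<noteq> 0" for n
    unfolding A_def B_def x_def lower by (rule den1, rule den2)
  \<comment> \<open>This translates the contiguous relations, stated in \<open>z\<close>, into
    relations in \<open>c1\<close> and \<open>c2\<close>.\<close>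
  have c1z: "c1 = c2 * (1 - z)" using c2 by (simp add: z field_simps)
  have start: "A 0 = 1" "B 0 = 1 + x * z"
    by (simp_all add: A_def B_def hyp2F1_def)
  have odd: "2 * (2 * real n + 3) * B (Suc n)
      = 2 * (2 * real n + 3 - (real n + 1) * z) * A (Suc n) + (x + 2 * real n + 2) * z * B n" for n
    using hyp2F1_contiguous_odd[where n = n and x = x and z = z] by (simp add: A_def B_def numeral_eq_Suc)
  have even: "2 * (2 * real n + 1) * (1 - z) * A (Suc n)
      = (2 * real n + 1) * (2 - z) * B n - (x + 2 * real n + 1) * z * A n" for n
    using hyp2F1_contiguous_even[where n = n and x = x and z = z] by (simp add: A_def B_def numeral_eq_Suc)

  \<comment> \<open>Entries of the factors in terms of \<open>A\<close> and \<open>B\<close>\<close>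
  have a1: "a (6 * n + 1) = (x + 2 * real n) / c1" for n
    unfolding a_def lag2_a_simps by (simp add: x_def)
  \<comment> \<open>Here the Pochhammer quotient is 1, as \<open>pochhammer 0 0 = 1\<close>, and not
    \<open>1 / 2\<close> as in the later entries of this residue class.\<close>
  have a2_0: "a 2 = x * (c1 - c2) / (c1 * c2)"
    using lag2_a_simps(2)[of \<alpha>0 c1 c2 0] by (simp add: a_def x_def hyp2F1_def numeral_2_eq_2)
  have a2: "a (6 * n + 8) = (x + 2 * real n + 2) * (c1 - c2) / (2 * c1 * c2) * (B n / A (Suc n))"
    for n
  proof -
    have arg: "6 * n + 8 = 6 * Suc n + 2" "real n + 1 = real (Suc n)" "real n + 2 = real (Suc n) + 1"
      "n + 1 = Suc n" "x + 2 * real n + 2 = \<alpha>0 + 2 * real (Suc n) + 1"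
      by (simp_all add: x_def)
    have "B n = hyp2F1 (Suc n) (\<alpha>0 + 1) (- 2 * real (Suc n) + 1) z"
      "A (Suc n) = hyp2F1 (Suc n) (\<alpha>0 + 1) (- 2 * real (Suc n)) z"
      by (simp_all add: A_def B_def x_def)
    then have "a (6 * n + 8) = pochhammer (real n + 1) (n + 1) / pochhammer (real n + 2) (n + 1)
        * ((x + 2 * real n + 2) * (c1 - c2) / (c1 * c2)) * (B n / A (Suc n))"
      unfolding a_def arg lag2_a_simps(2) z[symmetric] by simp
    then show ?thesis unfolding pochhammer_ratio_half by simp
  qed
  have a3: "a (6 * n + 3) = (2 * real n + 1) / c1 * (B n / A n)" for n
    unfolding a_def lag2_a_simps z[symmetric] A_def B_def x_def lower by simp
  have a4: "a (6 * n + 4) = (x + 2 * real n + 1) / c2" for n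
    unfolding a_def lag2_a_simps by (simp add: x_def)
  have a5: "a (6 * n + 5) = (real n + 1) * (x + 2 * real n + 1) * (c2 - c1)
      / ((2 * real n + 1) * c1 * c2) * (A n / B n)" for n
    unfolding a_def lag2_a_simps z[symmetric] A_def B_def x_def lower by simp
  have a6: "a (6 * n + 6) = 2 * (real n + 1) / c2 * (A (Suc n) / B n)" for n
    unfolding a_def lag2_a_simps z[symmetric] A_def B_def x_def lower(2,3) by simp
  have a9: "a (6 * n + 9) = (2 * real n + 3) / c1 * (B (Suc n) / A (Suc n))" for n
    using a3[of "Suc n"] by (simp add: algebra_simps)
  have a7: "a (6 * n + 7) = (x + 2 * real n + 2) / c1" for n
    using a1[of "Suc n"] by (simp add: algebra_simps)

  \<comment> \<open>Sums and products of neighbouring entries\<close>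
  have s0: "a 2 + a 3 = 1 / c1"
    using a3[of 0] c1 c2 by (simp add: a2_0 start c1z field_simps)
  \<comment> \<open>With denominators cleared, \<open>odd\<close> replaces \<open>B (Suc n)\<close>;
    the terms in \<open>B n\<close> cancel because \<open>c2 * z = c2 - c1\<close>, and
    \<open>A (Suc n)\<close> factors out.\<close>
  have s_odd: "a (6 * n + 8) + a (6 * n + 9) = ((real n + 1) * c1 + (real n + 2) * c2) / (c1 * c2)"
    for n
  proof -
    have "2 * c1 * c2 * A (Suc n) * (a (6 * n + 8) + a (6 * n + 9))
        = (x + 2 * real n + 2) * (c1 - c2) * B n + c2 * (2 * (2 * real n + 3) * B (Suc n))"
      unfolding a2 a9 using c1 c2 A0[of "Suc n"] by (simp add: field_simps)
    also have "\<dots> = 2 * c1 * c2 * A (Suc n)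
        * (((real n + 1) * c1 + (real n + 2) * c2) / (c1 * c2))"
      using c1 c2 unfolding odd by (simp add: c1z) (simp add: algebra_simps)
    finally show ?thesis unfolding mult_cancel_left using c1 c2 A0[of "Suc n"] by simp
  qed
  \<comment> \<open>Here \<open>c1 = c2 * (1 - z)\<close> produces the left side of
    \<open>even\<close>, after which the terms in \<open>A n\<close> cancel.\<close>
  have s_even: "a (6 * n + 5) + a (6 * n + 6) = (real n + 1) * (c1 + c2) / (c1 * c2)" for n
  proof -
    have N: "2 * real n + 1 \<noteq> 0" by linarith
    have "(2 * real n + 1) * c1 * c2 * B n * (a (6 * n + 5) + a (6 * n + 6))
        = (real n + 1) * ((x + 2 * real n + 1) * (c2 - c1) * A n
            + 2 * (2 * real n + 1) * c1 * A (Suc n))"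
      unfolding a5 a6 distrib_left using c1 c2 B0[of n] N
      by (simp add: divide_simps) (simp add: algebra_simps)
    also have "\<dots> = (real n + 1) * ((x + 2 * real n + 1) * (c2 - c1) * A n
            + c2 * (2 * (2 * real n + 1) * (1 - z) * A (Suc n)))"
      by (simp add: c1z)
    also have "\<dots> = (2 * real n + 1) * c1 * c2 * B n * ((real n + 1) * (c1 + c2) / (c1 * c2))"
      using c1 c2 unfolding even by (simp add: c1z) (simp add: algebra_simps)
    finally show ?thesis unfolding mult_cancel_left using c1 c2 B0[of n] N by simp
  qed
  have p_even: "a (6 * n + 5) * a (6 * n + 3)
      = (real n + 1) * (x + 2 * real n + 1) * (c2 - c1) / (c1 ^ 2 * c2)" for n
    using c1 c2 A0[of n] B0[of n] by (simp add: a5 a3 divide_simps power2_eq_square)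
  have p_odd: "a (6 * n + 8) * a (6 * n + 6)
      = (real n + 1) * (x + 2 * real n + 2) * (c1 - c2) / (c1 * c2 ^ 2)" for n
    using c1 c2 A0[of "Suc n"] B0[of n] 
      by (simp add: a2 a6 divide_simps power2_eq_square) (simp add: algebra_simps)

  have a1_0: "a 1 = x / c1" using a1[of 0] by simp
  \<comment> \<open>At \<open>n = 0\<close> the formula gives \<open>1 / c1\<close>, so
    \<open>s0\<close> and the shifted \<open>s_odd\<close> merge into one statement.\<close>
  have s_even': "a (6 * n + 2) + a (6 * n + 3) = (real n * c1 + (real n + 1) * c2) / (c1 * c2)" for n
  proof (cases n)
    case 0
    then show ?thesis using s0 c2 by (simp add: numeral_2_eq_2)
  next
    case (Suc l)
    then show ?thesis using s_odd[of l] by (simp add: algebra_simps)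
  qed
  have parity: "\<exists>n. i = 2 * n \<or> i = 2 * n + 1" for i :: nat
    by presburger
  \<comment> \<open>The right sides are bracketed so that the sums and products found above can be
    substituted directly. No series remains, only rational identities for each parity of
    \<open>i\<close>.\<close>
  have step: "lag2_b \<alpha>0 c1 c2 (Suc i) = a (3 * i + 4) + (a (3 * i + 2) + a (3 * i + 3))
    \<and> lag2_c \<alpha>0 c1 c2 (i + 2) = (a (3 * i + 5) + a (3 * i + 6)) * a (3 * i + 4)
        + a (3 * i + 5) * a (3 * i + 3)
    \<and> lag2_d \<alpha>0 c1 c2 (i + 2) = a (3 * i + 5) * a (3 * i + 3) * a (3 * i + 1)" for i
  proof -
    obtain n where "i = 2 * n \<or> i = 2 * n + 1" using parity by blast
    then show ?thesis
    proof
      assume i: "i = 2 * n"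
      then have "3 * i = 6 * n" by simp
      show ?thesis
        unfolding \<open>3 * i = 6 * n\<close> a1 a4 s_even s_even' p_even using c1 c2
        by (simp add: i lag2_b_def lag2_c_def lag2_d_def x_def divide_simps)
          (simp add: algebra_simps power2_eq_square power3_eq_cube)
    next
      assume i: "i = 2 * n + 1"
      then have idx: "3 * i + 1 = 6 * n + 4" "3 * i + 2 = 6 * n + 5" "3 * i + 3 = 6 * n + 6"
        "3 * i + 4 = 6 * n + 7" "3 * i + 5 = 6 * n + 8" "3 * i + 6 = 6 * n + 9"
        by simp_all
      show ?thesis
        unfolding idx a4 a7 s_even s_odd p_odd using c1 c2
        by (simp add: i lag2_b_def lag2_c_def lag2_d_def x_def divide_simps)
          (simp add: algebra_simps power2_eq_square power3_eq_cube)
    qed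
  qed
  show ?thesis
    unfolding a_def[symmetric]
  proof (rule tetra_T_eq_bidiag_mult)
    show "lag2_b \<alpha>0 c1 c2 0 = a 1"
      unfolding a1_0 using c1 c2 by (simp add: lag2_b_def x_def field_simps)
    show "lag2_c \<alpha>0 c1 c2 1 = (a 2 + a 3) * a 1"
      unfolding a1_0 s0 using c1 c2
      by (simp add: lag2_c_def x_def field_simps power2_eq_square)
  qed (use step in \<open>simp_all add: add.assoc\<close>)
qed

end
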